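(* Let $(\mathfrak h,\langle\,,\,\rangle_{\mathfrak h})$ and $(\mathfrak d,\langle\,,\,\rangle_{\mathfrak d})$ be Lie algebras with ad-invariant metrics, let $\pi:\mathfrak h\to\mathrm{Dera}(\mathfrak d,\langle\,,\,\rangle_{\mathfrak d})$ be a Lie algebra homomorphism, and let $\mathcal G(\mathfrak d)=\mathfrak d\oplus\mathfrak h^*$ be the Lie algebra with the bracket given in the context. (1) If $\mathfrak d$ is $k$-step solvable, then $\mathcal G(\mathfrak d)$ is either $k$- or $(k+1)$-step solvable. It is $k$-step solvable if and only if $$\langle\pi(h)x,y\rangle_{\mathfrak d}=0\qquad\text{for all }h\in\mathfrak h,\ x,y\in C^{k-1}(\mathfrak d).$$ (2) If $\mathfrak d$ is $k$-step nilpotent, then $\mathcal G(\mathfrak d)$ is either $k$- or $(k+1)$-step nilpotent. It is $k$-step nilpotent if and only if $$D^{k-1}(\mathfrak d)\subseteq\bigcap_{h\in\mathfrak h}\ker\pi(h).$$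
   Context: All Lie algebras are real and finite-dimensional. An ad-invariant metric on a Lie algebra is a nondegenerate symmetric bilinear form $B$ (of any signature) with $B([x,y],z)=-B(y,[x,z])$. $\mathrm{Dera}(\mathfrak d,\langle\,,\,\rangle_{\mathfrak d})$ is the Lie algebra of derivations of $\mathfrak d$ that are skew-symmetric for $\langle\,,\,\rangle_{\mathfrak d}$. Define $\beta:\mathfrak d\times\mathfrak d\to\mathfrak h^*$ by $\beta(x_1,x_2)(h)=\langle\pi(h)x_1,x_2\rangle_{\mathfrak d}$. The Lie algebra $\mathcal G(\mathfrak d)$ is $\mathfrak d\oplus\mathfrak h^*$ with bracket $[x_1+\alpha_1,x_2+\alpha_2]=[x_1,x_2]_{\mathfrak d}+\beta(x_1,x_2)$ for $x_i\in\mathfrak d$, $\alpha_i\in\mathfrak h^*$. For a Lie algebra $\mathfrak g$: $C^0(\mathfrak g)=\mathfrak g=D^0(\mathfrak g)$, $C^i(\mathfrak g)=[C^{i-1}(\mathfrak g),C^{i-1}(\mathfrak g)]$ and $D^i(\mathfrak g)=[\mathfrak g,D^{i-1}(\mathfrak g)]$ for $i\ge1$. For $k\geq 1$, $\mathfrak g$ is $k$-step solvable if $C^k(\mathfrak g)=0$ and $C^{k-1}(\mathfrak g)\ne0$; it is $k$-step nilpotent if $D^k(\mathfrak g)=0$ and $D^{k-1}(\mathfrak g)\neq0$. *)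

theory Defs
  imports "HOL-Analysis.Analysis"
begin

section \<open>Lie algebras with ad-invariant metrics\<close>

text \<open>
  The underlying vector space is a whole type of class \<^class>\<open>real_vector\<close>, with an explicit
  finite-dimensionality condition. (The class \<open>euclidean_space\<close> would exclude the zero
  space and single out a positive definite inner product.)
\<close>

definition finite_dim :: "'a::real_vector itself \<Rightarrow> bool" where
  "finite_dim _ \<longleftrightarrow> (\<exists>B::'a set. finite B \<and> span B = UNIV)"

definition lie_algebra :: "('a::real_vector \<Rightarrow> 'a \<Rightarrow> 'a) \<Rightarrow> bool" where
  "lie_algebra br \<longleftrightarrow>
     finite_dim TYPE('a) \<and> bilinear br \<and> (\<forall>x. br x x = 0) \<and>
     (\<forall>x y z. br x (br y z) + br y (br z x) + br z (br x y) = 0)"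

definition ad_invariant_metric ::
  "('a::real_vector \<Rightarrow> 'a \<Rightarrow> 'a) \<Rightarrow> ('a \<Rightarrow> 'a \<Rightarrow> real) \<Rightarrow> bool" where
  "ad_invariant_metric br B \<longleftrightarrow>
     bilinear B \<and> (\<forall>x y. B x y = B y x) \<and>
     (\<forall>x. (\<forall>y. B x y = 0) \<longrightarrow> x = 0) \<and>
     (\<forall>x y z. B (br x y) z = - B y (br x z))"

definition Dera ::
  "('a::real_vector \<Rightarrow> 'a \<Rightarrow> 'a) \<Rightarrow> ('a \<Rightarrow> 'a \<Rightarrow> real) \<Rightarrow> ('a \<Rightarrow> 'a) set" where
  "Dera br B =
     {D. linear D \<and> (\<forall>x y. D (br x y) = br (D x) y + br x (D y)) \<and>
         (\<forall>x y. B (D x) y = - B x (D y))}"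

text \<open>
  Lie algebra homomorphisms \<open>\<hh> \<rightarrow> Dera(\<dd>)\<close>, where \<open>Dera(\<dd>)\<close> carries the pointwise vector space
  structure and the commutator bracket.
\<close>

definition Dera_hom ::
  "('h::real_vector \<Rightarrow> 'h \<Rightarrow> 'h) \<Rightarrow> ('d::real_vector \<Rightarrow> 'd \<Rightarrow> 'd) \<Rightarrow> ('d \<Rightarrow> 'd \<Rightarrow> real)
    \<Rightarrow> ('h \<Rightarrow> 'd \<Rightarrow> 'd) \<Rightarrow> bool" where
  "Dera_hom brh br B \<pi> \<longleftrightarrow>
     (\<forall>h. \<pi> h \<in> Dera br B) \<and> (\<forall>x. linear (\<lambda>h. \<pi> h x)) \<and>
     (\<forall>h k x. \<pi> (brh h k) x = \<pi> h (\<pi> k x) - \<pi> k (\<pi> h x))"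


section \<open>Derived series and lower central series\<close>

definition bracket_span :: "('a::real_vector \<Rightarrow> 'a \<Rightarrow> 'a) \<Rightarrow> 'a set \<Rightarrow> 'a set \<Rightarrow> 'a set" where
  "bracket_span br U V = span {br u v |u v. u \<in> U \<and> v \<in> V}"

primrec derived_series :: "('a::real_vector \<Rightarrow> 'a \<Rightarrow> 'a) \<Rightarrow> nat \<Rightarrow> 'a set" where
  "derived_series br 0 = UNIV"
| "derived_series br (Suc i) = bracket_span br (derived_series br i) (derived_series br i)"

primrec lower_central_series :: "('a::real_vector \<Rightarrow> 'a \<Rightarrow> 'a) \<Rightarrow> nat \<Rightarrow> 'a set" where
  "lower_central_series br 0 = UNIV"
| "lower_central_series br (Suc i) = bracket_span br UNIV (lower_central_series br i)"

definition step_solvable :: "nat \<Rightarrow> ('a::real_vector \<Rightarrow> 'a \<Rightarrow> 'a) \<Rightarrow> bool" where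
  "step_solvable k br \<longleftrightarrow>
     k \<ge> 1 \<and> derived_series br k = {0} \<and> derived_series br (k - 1) \<noteq> {0}"

definition step_nilpotent :: "nat \<Rightarrow> ('a::real_vector \<Rightarrow> 'a \<Rightarrow> 'a) \<Rightarrow> bool" where
  "step_nilpotent k br \<longleftrightarrow>
     k \<ge> 1 \<and> lower_central_series br k = {0} \<and> lower_central_series br (k - 1) \<noteq> {0}"


section \<open>The dual space\<close>

typedef (overloaded) 'a dual_space = "{f :: 'a::real_vector \<Rightarrow> real. linear f}"
  morphisms dual_apply Abs_dual
  by (rule exI[of _ "\<lambda>_. 0"]) (simp add: linear_iff)

setup_lifting type_definition_dual_space

instantiation dual_space :: (real_vector) real_vector
begin

lift_definition zero_dual_space :: "'a dual_space" is "\<lambda>_. 0"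
  by (simp add: linear_iff)

lift_definition plus_dual_space :: "'a dual_space \<Rightarrow> 'a dual_space \<Rightarrow> 'a dual_space"
  is "\<lambda>f g x. f x + g x"
  by (rule linear_compose_add)

lift_definition minus_dual_space :: "'a dual_space \<Rightarrow> 'a dual_space \<Rightarrow> 'a dual_space"
  is "\<lambda>f g x. f x - g x"
  by (rule linear_compose_sub)

lift_definition uminus_dual_space :: "'a dual_space \<Rightarrow> 'a dual_space"
  is "\<lambda>f x. - f x"
  by (rule linear_compose_neg)

lift_definition scaleR_dual_space :: "real \<Rightarrow> 'a dual_space \<Rightarrow> 'a dual_space"
  is "\<lambda>c f x. c *\<^sub>R f x"
  by (rule linear_compose_scale_right)

instance
  by standard (transfer; simp add: algebra_simps)+

end


section \<open>The Lie algebra \<open>\<G>(\<dd>)\<close>\<close>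

text \<open>
  \<^const>\<open>Abs_dual\<close> is meaningful only on linear functionals; the lemma \<open>beta_apply\<close> below shows that
  this is the case here.
\<close>

definition beta ::
  "('d::real_vector \<Rightarrow> 'd \<Rightarrow> real) \<Rightarrow> ('h::real_vector \<Rightarrow> 'd \<Rightarrow> 'd) \<Rightarrow> 'd \<Rightarrow> 'd \<Rightarrow> 'h dual_space"
  where "beta B \<pi> x\<^sub>1 x\<^sub>2 = Abs_dual (\<lambda>h. B (\<pi> h x\<^sub>1) x\<^sub>2)"

definition G_bracket ::
  "('d::real_vector \<Rightarrow> 'd \<Rightarrow> 'd) \<Rightarrow> ('d \<Rightarrow> 'd \<Rightarrow> real) \<Rightarrow> ('h::real_vector \<Rightarrow> 'd \<Rightarrow> 'd)
    \<Rightarrow> 'd \<times> 'h dual_space \<Rightarrow> 'd \<times> 'h dual_space \<Rightarrow> 'd \<times> 'h dual_space" where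
  "G_bracket br B \<pi> u v = (br (fst u) (fst v), beta B \<pi> (fst u) (fst v))"

lemma beta_apply:
  assumes "ad_invariant_metric br B" "Dera_hom brh br B \<pi>"
  shows "dual_apply (beta B \<pi> x y) h = B (\<pi> h x) y"
proof -
  have "linear ((\<lambda>x. B x y) \<circ> (\<lambda>h. \<pi> h x))"
    using assms by (intro linear_compose) (auto simp: ad_invariant_metric_def Dera_hom_def bilinear_def)
  then show ?thesis
    by (simp add: beta_def Abs_dual_inverse o_def)
qed

lemma finite_dim_dual_space:
  assumes "finite_dim TYPE('a::real_vector)"
  shows "finite_dim TYPE('a dual_space)"
proof -
  obtain S :: "'a set" where "finite S" "span S = UNIV"
    using assms by (auto simp: finite_dim_def)
  then obtain B :: "'a set" where B: "finite B" "independent B" "span B = UNIV"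
    by (metis maximal_independent_subset finite_subset span_mono span_span top.extremum_uniqueI)
  define c where "c b = Abs_dual (\<lambda>v. representation B v b)" for b
  have c: "dual_apply (c b) v = representation B v b" for b v
  proof -
    have "linear (\<lambda>v. representation B v b)"
      using B by (simp add: linear_iff representation_add representation_scale)
    then show ?thesis by (simp add: c_def Abs_dual_inverse)
  qed
  have "f \<in> span (c ` B)" for f
  proof -
    have sum_apply: "dual_apply (\<Sum>b\<in>A. g b) v = (\<Sum>b\<in>A. dual_apply (g b) v)"
      for g :: "'a \<Rightarrow> 'a dual_space" and A v
      by (induction A rule: infinite_finite_induct) (auto simp: zero_dual_space.rep_eq plus_dual_space.rep_eq)
    have "f = (\<Sum>b\<in>B. dual_apply f b *\<^sub>R c b)"
    proof (rule dual_apply_inject[THEN iffD1], rule ext)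
      fix v
      have lin: "linear (dual_apply f)" using dual_apply by auto
      have "dual_apply f v = dual_apply f (\<Sum>b\<in>B. representation B v b *\<^sub>R b)"
        using B by (subst sum_representation_eq) auto
      then show "dual_apply f v = dual_apply (\<Sum>b\<in>B. dual_apply f b *\<^sub>R c b) v"
        by (simp add: linear_sum[OF lin] linear_scale[OF lin] sum_apply scaleR_dual_space.rep_eq c mult.commute)
    qed
    also have "\<dots> \<in> span (c ` B)"
      by (intro span_sum span_scale span_base) auto
    finally show ?thesis .
  qed
  then show ?thesis using B(1) by (auto simp: finite_dim_def)
qed

lemma finite_dim_prod:
  assumes "finite_dim TYPE('a::real_vector)" "finite_dim TYPE('b::real_vector)"
  shows "finite_dim TYPE('a \<times> 'b)"
proof -
  obtain A :: "'a set" and B :: "'b set"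
    where AB: "finite A" "span A = UNIV" "finite B" "span B = UNIV"
    using assms by (auto simp: finite_dim_def)
  let ?S = "(\<lambda>x. (x, 0)) ` A \<union> (\<lambda>y. (0, y)) ` B"
  have "(x, y) \<in> span ?S" for x y
  proof -
    have "linear (\<lambda>x::'a. (x, 0::'b))" "linear (\<lambda>y::'b. (0::'a, y))"
      by (auto simp: linear_iff)
    then have "(x, 0) \<in> span ((\<lambda>x. (x, 0::'b)) ` A)" "(0, y) \<in> span ((\<lambda>y. (0::'a, y)) ` B)"
      using AB by (auto simp: linear_span_image)
    then have "(x, 0) \<in> span ?S" "(0, y) \<in> span ?S"
      by (meson span_mono subsetD Un_upper1 Un_upper2)+
    then have "(x, 0) + (0, y) \<in> span ?S" by (rule span_add)
    then show ?thesis by simp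
  qed
  then have "span ?S = UNIV" by auto
  then show ?thesis using AB by (auto simp: finite_dim_def intro!: exI[of _ ?S])
qed

lemma lie_algebra_G_bracket:
  fixes brh :: "'h::real_vector \<Rightarrow> 'h \<Rightarrow> 'h" and br :: "'d::real_vector \<Rightarrow> 'd \<Rightarrow> 'd"
  assumes h: "lie_algebra brh" and d: "lie_algebra br"
    and B: "ad_invariant_metric br B" and \<pi>: "Dera_hom brh br B \<pi>"
  shows "lie_algebra (G_bracket br B \<pi>)"
proof -
  note beta = beta_apply[OF B \<pi>]
  note B' = B[unfolded ad_invariant_metric_def] and d' = d[unfolded lie_algebra_def]
    and \<pi>' = \<pi>[unfolded Dera_hom_def Dera_def mem_Collect_eq]
  have bil: "bilinear B" "bilinear br"
    using B' d' by metis+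
  have sym: "B x y = B y x" and inv: "B (br x y) z = - B y (br x z)" for x y z
    using B' by metis+
  have lin: "linear (\<pi> h)" and der: "\<pi> h (br x y) = br (\<pi> h x) y + br x (\<pi> h y)"
    and skew: "B (\<pi> h x) y = - B x (\<pi> h y)" for h x y
    using \<pi>' by metis+
  have alt: "br x x = 0" and jac: "br x (br y z) + br y (br z x) + br z (br x y) = 0" for x y z
    using d' by metis+
  have anti: "br x y = - br y x" for x y
    using alt[of "x + y"] alt[of x] alt[of y] bil(2)
    by (simp add: bilinear_ladd bilinear_radd eq_neg_iff_add_eq_0)
  have eqI: "f = g" if "\<And>h. dual_apply f h = dual_apply g h" for f g :: "'h dual_space"
    using that dual_apply_inject by blast
  note rep = zero_dual_space.rep_eq plus_dual_space.rep_eq scaleR_dual_space.rep_eq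
  have fin: "finite_dim TYPE('d \<times> 'h dual_space)"
    using h d by (intro finite_dim_prod finite_dim_dual_space) (simp_all add: lie_algebra_def)
  have b1: "beta B \<pi> x (y + z) = beta B \<pi> x y + beta B \<pi> x z"
    and b2: "beta B \<pi> (x + y) z = beta B \<pi> x z + beta B \<pi> y z"
    and b3: "beta B \<pi> x (c *\<^sub>R y) = c *\<^sub>R beta B \<pi> x y"
    and b4: "beta B \<pi> (c *\<^sub>R x) y = c *\<^sub>R beta B \<pi> x y" for x y z c
    by (rule eqI; simp add: beta rep linear_add[OF lin] linear_scale[OF lin] bilinear_ladd[OF bil(1)]
          bilinear_radd[OF bil(1)] bilinear_lmul[OF bil(1)] bilinear_rmul[OF bil(1)])+
  have b5: "beta B \<pi> x x = 0" for x
  proof (rule eqI)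
    fix h show "dual_apply (beta B \<pi> x x) h = dual_apply 0 h"
      using skew[of h x x] sym[of x "\<pi> h x"] by (simp add: beta rep)
  qed
  have b6: "beta B \<pi> x (br y z) + beta B \<pi> y (br z x) + beta B \<pi> z (br x y) = 0" for x y z
  proof (rule eqI)
    fix h
    have 1: "B (\<pi> h x) (br y z) = - B x (br (\<pi> h y) z) - B x (br y (\<pi> h z))"
      by (simp add: skew der bilinear_radd[OF bil(1)])
    have 2: "B x (br (\<pi> h y) z) = B (\<pi> h y) (br z x)"
      using inv[of z "\<pi> h y" x] anti[of "\<pi> h y" z] sym[of x "br z (\<pi> h y)"]
      by (simp add: bilinear_rneg[OF bil(1)])
    have 3: "B x (br y (\<pi> h z)) = B (\<pi> h z) (br x y)"
      using inv[of y "\<pi> h z" x] anti[of x y] sym[of x "br y (\<pi> h z)"]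
      by (simp add: bilinear_rneg[OF bil(1)])
    show "dual_apply (beta B \<pi> x (br y z) + beta B \<pi> y (br z x) + beta B \<pi> z (br x y)) h = dual_apply 0 h"
      using 1 2 3 by (simp add: beta rep)
  qed
  show ?thesis
    unfolding lie_algebra_def
    using fin
    by (auto simp: G_bracket_def bilinear_def linear_iff zero_prod_def alt jac b1 b2 b3 b4 b5 b6
        bilinear_ladd[OF bil(2)] bilinear_radd[OF bil(2)] bilinear_lmul[OF bil(2)] bilinear_rmul[OF bil(2)])
qed

end

theory Submission
  imports Defs
begin

text \<open>
  The projection \<open>fst\<close> is a surjective Lie algebra homomorphism \<open>\<G>(\<dd>) \<rightarrow> \<dd>\<close>, and the bracket of
  \<open>\<G>(\<dd>)\<close> depends on its arguments only through their projections: \<open>\<G>(\<dd>)\<close> is a central extension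
  of \<open>\<dd>\<close> by \<open>\<hh>\<^sup>*\<close>. Two consequences carry the proof.

  Firstly, each term of the derived or lower central series of \<open>\<G>(\<dd>)\<close> projects onto the
  corresponding term for \<open>\<dd>\<close> (\<open>fst_image_derived_series\<close>, \<open>fst_image_lower_central_series\<close>).
  Hence the series of \<open>\<G>(\<dd>)\<close> cannot reach zero before that of \<open>\<dd>\<close>. Once the series of \<open>\<dd>\<close> is zero,
  that of \<open>\<G>(\<dd>)\<close> lies in the central summand \<open>\<hh>\<^sup>*\<close>, so its next term is zero. This leaves only the
  lengths \<open>k\<close> and \<open>k + 1\<close>.

  Secondly, whether a term of the series of \<open>\<G>(\<dd>)\<close> is zero can be read off in \<open>\<dd>\<close>: the brackets of
  \<open>\<dd>\<close> and the values of \<open>\<beta>\<close> on the preceding terms have to be zero (\<open>bracket_span_G_eq_0_iff\<close>).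
  If the \<open>k\<close>-th term for \<open>\<dd>\<close> is zero, only \<open>\<beta>\<close> is left, which gives the criterion in the solvable
  case. In the nilpotent case one argument of \<open>\<beta>\<close> ranges over all of \<open>\<dd>\<close>, and nondegeneracy of the
  metric turns the vanishing of \<open>\<beta>\<close> into the vanishing of \<open>\<pi>(h)\<close>.
\<close>

lemma bracket_span_eq_0_iff:
  fixes br :: "'a::real_vector \<Rightarrow> 'a \<Rightarrow> 'a"
  shows "bracket_span br U V = {0} \<longleftrightarrow> (\<forall>u\<in>U. \<forall>v\<in>V. br u v = 0)"
proof -
  have span_trivial: "span S = {0} \<longleftrightarrow> S \<subseteq> {0}" for S :: "'a set"
  proof
    show "S \<subseteq> {0}" if "span S = {0}"
      using span_superset[of S] that by simp
  next
    assume "S \<subseteq> {0}"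
    then have "span S \<subseteq> {0}"
      by (rule span_minimal) simp
    then show "span S = {0}"
      using span_zero[of S] by auto
  qed
  have "bracket_span br U V = {0} \<longleftrightarrow> {br u v |u v. u \<in> U \<and> v \<in> V} \<subseteq> {0}"
    unfolding bracket_span_def by (rule span_trivial)
  also have "\<dots> \<longleftrightarrow> (\<forall>u\<in>U. \<forall>v\<in>V. br u v = 0)"
    by blast
  finally show ?thesis .
qed

lemma fst_image_bracket_span_G:
  "fst ` bracket_span (G_bracket br B \<pi>) U V = bracket_span br (fst ` U) (fst ` V)"
proof -
  have proj: "fst (G_bracket br B \<pi> u v) = br (fst u) (fst v)" for u v
    by (simp add: G_bracket_def)
  have "fst ` {G_bracket br B \<pi> u v |u v. u \<in> U \<and> v \<in> V}
      = {fst (G_bracket br B \<pi> u v) |u v. u \<in> U \<and> v \<in> V}"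
    by blast
  also have "\<dots> = {br x y |x y. x \<in> fst ` U \<and> y \<in> fst ` V}"
    unfolding proj by blast
  finally have "fst ` {G_bracket br B \<pi> u v |u v. u \<in> U \<and> v \<in> V}
      = {br x y |x y. x \<in> fst ` U \<and> y \<in> fst ` V}" .
  then show ?thesis
    by (simp add: bracket_span_def linear_span_image[OF linear_fst, symmetric])
qed

lemma fst_image_derived_series:
  "fst ` derived_series (G_bracket br B \<pi>) i = derived_series br i"
  by (induction i) (simp_all add: fst_image_bracket_span_G)

lemma fst_image_lower_central_series:
  "fst ` lower_central_series (G_bracket br B \<pi>) i = lower_central_series br i"
  by (induction i) (simp_all add: fst_image_bracket_span_G)

lemma beta_eq_0_iff:
  assumes "ad_invariant_metric br B" "Dera_hom brh br B \<pi>"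
  shows "beta B \<pi> x y = 0 \<longleftrightarrow> (\<forall>h. B (\<pi> h x) y = 0)"
  using beta_apply[OF assms, of x y]
  by (simp add: dual_apply_inject[symmetric] zero_dual_space.rep_eq fun_eq_iff)

lemma bracket_span_G_eq_0_iff:
  assumes "ad_invariant_metric br B" "Dera_hom brh br B \<pi>"
  shows "bracket_span (G_bracket br B \<pi>) U V = {0} \<longleftrightarrow>
    bracket_span br (fst ` U) (fst ` V) = {0} \<and>
    (\<forall>h. \<forall>x\<in>fst ` U. \<forall>y\<in>fst ` V. B (\<pi> h x) y = 0)"
proof -
  have "G_bracket br B \<pi> u v = 0 \<longleftrightarrow>
      br (fst u) (fst v) = 0 \<and> (\<forall>h. B (\<pi> h (fst u)) (fst v) = 0)" for u v
    by (simp add: G_bracket_def zero_prod_def beta_eq_0_iff[OF assms])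
  then show ?thesis
    unfolding bracket_span_eq_0_iff by (simp only: ball_simps) blast
qed

text \<open>
  The summand \<open>\<hh>\<^sup>*\<close> is central, because the bracket of \<open>\<G>(\<dd>)\<close> is bilinear and does not see the
  components in \<open>\<hh>\<^sup>*\<close>.
\<close>

lemma bracket_span_G_central:
  assumes "lie_algebra br" "ad_invariant_metric br B" "Dera_hom brh br B \<pi>" "fst ` V = {0}"
  shows "bracket_span (G_bracket br B \<pi>) U V = {0}"
proof -
  have "bilinear br" "bilinear B"
    using assms(1,2) by (simp_all add: lie_algebra_def ad_invariant_metric_def)
  then have "br x 0 = 0" "B x 0 = 0" for x
    by (blast intro: bilinear_rzero)+
  then show ?thesis
    by (simp add: bracket_span_G_eq_0_iff[OF assms(2,3)] bracket_span_eq_0_iff[of br] assms(4))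
qed

text \<open>
  Skew-symmetry of \<open>\<pi>(h)\<close> and symmetry of the metric give
  \<open>\<langle>\<pi>(h) x, y\<rangle> = - \<langle>\<pi>(h) y, x\<rangle>\<close>. As \<open>x\<close> ranges over the whole space, nondegeneracy applies
  to \<open>\<pi>(h) y\<close>.
\<close>

lemma metric_Dera_right_eq_0_iff:
  assumes "ad_invariant_metric br B" "Dera_hom brh br B \<pi>"
  shows "(\<forall>x. B (\<pi> h x) y = 0) \<longleftrightarrow> \<pi> h y = 0"
proof -
  have skew: "B (\<pi> h x) y = - B (\<pi> h y) x" for x
  proof -
    have sym: "B u v = B v u" for u v
      using assms(1) unfolding ad_invariant_metric_def by blast
    have "B (\<pi> h x) y = - B x (\<pi> h y)"
      using assms(2) unfolding Dera_hom_def Dera_def by blast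
    also have "B x (\<pi> h y) = B (\<pi> h y) x"
      by (rule sym)
    finally show ?thesis .
  qed
  have nondeg: "(\<forall>x. B (\<pi> h y) x = 0) \<longleftrightarrow> \<pi> h y = 0"
  proof
    assume "\<forall>x. B (\<pi> h y) x = 0"
    then show "\<pi> h y = 0"
      using assms(1) unfolding ad_invariant_metric_def by blast
  next
    have "bilinear B"
      using assms(1) unfolding ad_invariant_metric_def by blast
    then have "B 0 x = 0" for x
      by (rule bilinear_lzero)
    then show "\<forall>x. B (\<pi> h y) x = 0" if "\<pi> h y = 0"
      using that by simp
  qed
  show ?thesis
    unfolding nondeg[symmetric] skew neg_equal_0_iff_equal ..
qed

theorem proposition5p5:
  fixes brh :: "'h::real_vector \<Rightarrow> 'h \<Rightarrow> 'h" and Bh :: "'h \<Rightarrow> 'h \<Rightarrow> real"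
    and brd :: "'d::real_vector \<Rightarrow> 'd \<Rightarrow> 'd" and Bd :: "'d \<Rightarrow> 'd \<Rightarrow> real"
    and \<pi> :: "'h \<Rightarrow> 'd \<Rightarrow> 'd" and k :: nat
  assumes "lie_algebra brh" and "ad_invariant_metric brh Bh"
    and "lie_algebra brd" and "ad_invariant_metric brd Bd"
    and "Dera_hom brh brd Bd \<pi>"
  shows "(step_solvable k brd \<longrightarrow>
            (step_solvable k (G_bracket brd Bd \<pi>) \<or> step_solvable (k + 1) (G_bracket brd Bd \<pi>)) \<and>
            (step_solvable k (G_bracket brd Bd \<pi>) \<longleftrightarrow>
               (\<forall>h. \<forall>x \<in> derived_series brd (k - 1). \<forall>y \<in> derived_series brd (k - 1).
                  Bd (\<pi> h x) y = 0)))
       \<and> (step_nilpotent k brd \<longrightarrow>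
            (step_nilpotent k (G_bracket brd Bd \<pi>) \<or> step_nilpotent (k + 1) (G_bracket brd Bd \<pi>)) \<and>
            (step_nilpotent k (G_bracket brd Bd \<pi>) \<longleftrightarrow>
               lower_central_series brd (k - 1) \<subseteq> (\<Inter>h. {x. \<pi> h x = 0})))"
proof (rule conjI; rule impI)
  let ?G = "G_bracket brd Bd \<pi>"
  note d = assms(3-5)
  note vanish = bracket_span_G_eq_0_iff[OF assms(4,5)]
  assume sol: "step_solvable k brd"
  then obtain m where k: "k = Suc m"
    by (cases k) (auto simp: step_solvable_def)
  have zero: "derived_series brd (Suc m) = {0}" and nonzero: "derived_series brd m \<noteq> {0}"
    using sol by (simp_all add: step_solvable_def k)
  have lower: "derived_series ?G m \<noteq> {0}"
    using nonzero fst_image_derived_series[of brd Bd \<pi> m] by auto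
  have upper: "derived_series ?G (Suc (Suc m)) = {0}"
    unfolding derived_series.simps(2)[of _ "Suc m"]
    by (rule bracket_span_G_central[OF d]) (simp only: fst_image_derived_series zero)
  have crit: "derived_series ?G (Suc m) = {0} \<longleftrightarrow>
      (\<forall>h. \<forall>x\<in>derived_series brd m. \<forall>y\<in>derived_series brd m. Bd (\<pi> h x) y = 0)"
    using zero by (simp add: vanish fst_image_derived_series)
  have steps: "step_solvable (Suc m) ?G \<longleftrightarrow> derived_series ?G (Suc m) = {0}"
    "step_solvable (Suc m + 1) ?G \<longleftrightarrow> derived_series ?G (Suc m) \<noteq> {0}"
    using lower upper by (simp_all add: step_solvable_def del: derived_series.simps)
  show "(step_solvable k ?G \<or> step_solvable (k + 1) ?G) \<and>
      (step_solvable k ?G \<longleftrightarrow> (\<forall>h. \<forall>x \<in> derived_series brd (k - 1).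
        \<forall>y \<in> derived_series brd (k - 1). Bd (\<pi> h x) y = 0))"
    unfolding k diff_Suc_1 steps crit by (intro conjI refl disjCI) (erule notnotD)
next
  let ?G = "G_bracket brd Bd \<pi>"
  note d = assms(3-5)
  note vanish = bracket_span_G_eq_0_iff[OF assms(4,5)]
  assume nil: "step_nilpotent k brd"
  then obtain m where k: "k = Suc m"
    by (cases k) (auto simp: step_nilpotent_def)
  have zero: "lower_central_series brd (Suc m) = {0}"
    and nonzero: "lower_central_series brd m \<noteq> {0}"
    using nil by (simp_all add: step_nilpotent_def k)
  have lower: "lower_central_series ?G m \<noteq> {0}"
    using nonzero fst_image_lower_central_series[of brd Bd \<pi> m] by auto
  have upper: "lower_central_series ?G (Suc (Suc m)) = {0}"
    unfolding lower_central_series.simps(2)[of _ "Suc m"]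
    by (rule bracket_span_G_central[OF d]) (simp only: fst_image_lower_central_series zero)
  have "lower_central_series ?G (Suc m) = {0} \<longleftrightarrow>
      (\<forall>h. \<forall>x. \<forall>y\<in>lower_central_series brd m. Bd (\<pi> h x) y = 0)"
    using zero by (simp add: vanish fst_image_lower_central_series)
  also have "\<dots> \<longleftrightarrow> lower_central_series brd m \<subseteq> (\<Inter>h. {x. \<pi> h x = 0})"
    unfolding metric_Dera_right_eq_0_iff[OF assms(4,5), symmetric] by blast
  finally have crit: "lower_central_series ?G (Suc m) = {0} \<longleftrightarrow>
      lower_central_series brd m \<subseteq> (\<Inter>h. {x. \<pi> h x = 0})" .
  have steps: "step_nilpotent (Suc m) ?G \<longleftrightarrow> lower_central_series ?G (Suc m) = {0}"
    "step_nilpotent (Suc m + 1) ?G \<longleftrightarrow> lower_central_series ?G (Suc m) \<noteq> {0}"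
    using lower upper by (simp_all add: step_nilpotent_def del: lower_central_series.simps)
  show "(step_nilpotent k ?G \<or> step_nilpotent (k + 1) ?G) \<and>
      (step_nilpotent k ?G \<longleftrightarrow>
        lower_central_series brd (k - 1) \<subseteq> (\<Inter>h. {x. \<pi> h x = 0}))"
    unfolding k diff_Suc_1 steps crit by (intro conjI refl disjCI) (erule notnotD)
qed

end
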